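(* Let $0<\beta<1$ and let $\rho\in C(0,+\infty)\cap L^{1}_{Loc}[0,+\infty)$. For $t>0$ put $$y(t)=\int_{0}^{t}(t-s)^{\beta-1}\rho(s)\,ds.$$ (1) If $t^{\beta}\rho(t)$ is a nonincreasing function of $t$ on $(0,+\infty)$, then $y(t)$ is a nonincreasing function on $(0,+\infty)$. (2) If $t^{\beta}\rho(t)$ is a nondecreasing function of $t$ on $(0,+\infty)$, then $y(t)$ is a nondecreasing function on $(0,+\infty)$.
   Context: $C(0,+\infty)$ is the set of continuous real-valued functions on $(0,+\infty)$. $L^{1}_{Loc}[0,+\infty)$ is the space of all real-valued functions $f$ such that $|f|$ is Lebesgue integrable over every bounded subinterval of $[0,+\infty)$ (in particular near $0$). *)

theory Defs
  imports "HOL-Analysis.Analysis"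
begin

text \<open>
  Functions on the half-line are total functions on the reals, of which only the values on
  the half-line matter. Integrals are Lebesgue integrals; a single point is a null set, so the value
  at 0 plays no role. The predicate \<open>absolutely_integrable_on\<close> abbreviates Lebesgue
  integrability on a set, with respect to the complete Lebesgue measure.
\<close>

definition L1_loc :: "(real \<Rightarrow> real) set" where
  "L1_loc = {f. \<forall>I. is_interval I \<and> bounded I \<and> I \<subseteq> {0..} \<longrightarrow> f absolutely_integrable_on I}"

end

theory Submission
  imports Defs
begin

text \<open>
  Write \<open>g t = t powr \<beta> * \<rho> t\<close>. The weight \<open>(t - s) powr (\<beta> - 1) * s powr (- \<beta>)\<close> is
  homogeneous of degree \<open>-1\<close>, so the substitution \<open>s = t * \<sigma>\<close> removes \<open>t\<close> from it and from
  the domain: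

  \<open>y t = (LINT \<sigma>:{0<..<1}|lebesgue. (1 - \<sigma>) powr (\<beta> - 1) * \<sigma> powr (- \<beta>) * g (t * \<sigma>))\<close>.

  The new weight is nonnegative and independent of \<open>t\<close>, so \<open>y\<close> inherits the monotonicity of \<open>g\<close>,
  in either direction (\<open>fractional_integral_rescale\<close>, \<open>fractional_integral_le\<close>).

  Comparing two such integrals requires both to converge, since a divergent Lebesgue integral
  has the default value 0. Convergence (\<open>fractional_integrand_set_integrable\<close>) is where the
  hypotheses on \<open>\<rho>\<close> enter: near \<open>s = 0\<close> the kernel \<open>(t - s) powr (\<beta> - 1)\<close> is bounded and
  \<open>\<rho>\<close> is integrable, while near \<open>s = t\<close> the kernel is integrable and \<open>\<rho>\<close>, being continuous, is bounded.
\<close>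

lemma reflected_powr_set_integrable:
  fixes a t :: real
  assumes "-1 < a" and "0 \<le> t"
  shows "set_integrable lebesgue {0..t} (\<lambda>s. (t - s) powr a)"
proof -
  have "(\<lambda>x. x powr a) absolutely_integrable_on {0..t}"
    using integrable_on_powr_from_0[OF assms] by (intro nonnegative_absolutely_integrable_1) auto
  from lebesgue_integrable_real_affine[OF this[unfolded set_integrable_def], of "-1" t]
  have "integrable lebesgue (\<lambda>s. indicator {0..t} (t - s) *\<^sub>R (t - s) powr a)"
    by simp
  moreover have "indicator {0..t} (t - s) = (indicator {0..t} s :: real)" for s
    by (auto simp: indicator_def)
  ultimately show ?thesis
    by (simp add: set_integrable_def)
qed

text \<open>
  The two factors can be unbounded only at opposite ends of the interval. On each half one factor
  is integrable and the other is bounded.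
\<close>

lemma fractional_integrand_set_integrable:
  fixes \<beta> t :: real and \<rho> :: "real \<Rightarrow> real"
  assumes "0 < \<beta>" and "\<beta> < 1" and "0 < t"
    and cont: "continuous_on {0<..} \<rho>"
    and int: "set_integrable lebesgue {0<..<t} \<rho>"
  shows "set_integrable lebesgue {0<..<t} (\<lambda>s. (t - s) powr (\<beta> - 1) * \<rho> s)"
proof -
  have meas: "set_borel_measurable lebesgue A (\<lambda>s. (t - s) powr (\<beta> - 1) * \<rho> s)"
    if "A \<subseteq> {0<..<t}" "A \<in> sets borel" for A
  proof -
    have "continuous_on A (\<lambda>s. (t - s) powr (\<beta> - 1) * \<rho> s)"
      using that(1) by (intro continuous_intros continuous_on_subset[OF cont]) auto
    from borel_measurable_continuous_on_indicator[OF that(2) this] show ?thesis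
      unfolding set_borel_measurable_def by (intro measurable_completion) simp
  qed
  have left: "set_integrable lebesgue {0<..<t/2} (\<lambda>s. (t - s) powr (\<beta> - 1) * \<rho> s)"
  proof (rule set_integrable_bound)
    have "set_integrable lebesgue {0<..<t/2} \<rho>"
      using \<open>0 < t\<close> by (intro set_integrable_subset[OF int]) auto
    then show "set_integrable lebesgue {0<..<t/2} (\<lambda>s. (t/2) powr (\<beta> - 1) * \<rho> s)"
      by simp
    show "set_borel_measurable lebesgue {0<..<t/2} (\<lambda>s. (t - s) powr (\<beta> - 1) * \<rho> s)"
      using \<open>0 < t\<close> by (intro meas) auto
    have "(t - s) powr (\<beta> - 1) \<le> (t/2) powr (\<beta> - 1)" if "s < t/2" for s
      using that assms by (intro powr_mono2') auto
    then show "AE s in lebesgue. s \<in> {0<..<t/2} \<longrightarrow>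
        norm ((t - s) powr (\<beta> - 1) * \<rho> s) \<le> norm ((t/2) powr (\<beta> - 1) * \<rho> s)"
      by (auto simp: abs_mult intro!: AE_I2 mult_right_mono)
  qed
  have right: "set_integrable lebesgue {t/2..<t} (\<lambda>s. (t - s) powr (\<beta> - 1) * \<rho> s)"
  proof -
    have "compact (\<rho> ` {t/2..t})"
      using \<open>0 < t\<close> by (intro compact_continuous_image continuous_on_subset[OF cont]) auto
    then obtain M where "\<forall>x \<in> \<rho> ` {t/2..t}. norm x \<le> M"
      using compact_imp_bounded bounded_iff by metis
    then have M: "\<bar>\<rho> s\<bar> \<le> M" if "s \<in> {t/2..t}" for s
      using that by simp
    show ?thesis
    proof (rule set_integrable_bound)
      have "set_integrable lebesgue {t/2..<t} (\<lambda>s. (t - s) powr (\<beta> - 1))"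
        using reflected_powr_set_integrable[of "\<beta> - 1" t] assms
        by (rule_tac set_integrable_subset) auto
      then show "set_integrable lebesgue {t/2..<t} (\<lambda>s. (t - s) powr (\<beta> - 1) * M)"
        by simp
      show "set_borel_measurable lebesgue {t/2..<t} (\<lambda>s. (t - s) powr (\<beta> - 1) * \<rho> s)"
        using \<open>0 < t\<close> by (intro meas) auto
      have "\<bar>\<rho> s\<bar> \<le> \<bar>M\<bar>" if "s \<in> {t/2..<t}" for s
        using M[of s] that by auto
      then show "AE s in lebesgue. s \<in> {t/2..<t} \<longrightarrow>
          norm ((t - s) powr (\<beta> - 1) * \<rho> s) \<le> norm ((t - s) powr (\<beta> - 1) * M)"
        by (auto simp: abs_mult intro!: AE_I2 mult_left_mono)
    qed
  qed
  have "{0<..<t} = {0<..<t/2} \<union> {t/2..<t}"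
    using \<open>0 < t\<close> by auto
  then show ?thesis
    using set_integrable_Un[OF left right] by simp
qed

text \<open>
  Homogeneity of the kernel: the Jacobian \<open>t\<close>, the factor \<open>t powr (\<beta> - 1)\<close> from the kernel and
  the factor \<open>t powr (- \<beta>)\<close> needed to form \<open>(t * \<sigma>) powr \<beta>\<close> cancel.
\<close>

lemma fractional_integrand_rescale:
  fixes \<beta> t \<sigma> :: real
  assumes "0 < t"
  shows "t * (indicator {0<..<t} (t * \<sigma>) *\<^sub>R ((t - t * \<sigma>) powr (\<beta> - 1) * \<rho> (t * \<sigma>)))
       = indicator {0<..<1} \<sigma> *\<^sub>R
           ((1 - \<sigma>) powr (\<beta> - 1) * \<sigma> powr (- \<beta>) * ((t * \<sigma>) powr \<beta> * \<rho> (t * \<sigma>)))"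
proof (cases "\<sigma> \<in> {0<..<1}")
  case True
  then have "t * \<sigma> \<in> {0<..<t}"
    using assms by simp
  moreover have "(t - t * \<sigma>) powr (\<beta> - 1) = t powr (\<beta> - 1) * (1 - \<sigma>) powr (\<beta> - 1)"
    using powr_mult[of t "1 - \<sigma>" "\<beta> - 1"] True assms by (simp add: algebra_simps)
  moreover have "t * t powr (\<beta> - 1) = t powr \<beta>"
    using assms by (simp add: powr_mult_base)
  moreover have "\<sigma> powr (- \<beta>) * (t * \<sigma>) powr \<beta> = t powr \<beta>"
    using True assms by (simp add: powr_mult powr_minus)
  ultimately show ?thesis
    using True by (simp add: mult_ac)
next
  case False
  then have "t * \<sigma> \<notin> {0<..<t}"
    using assms by (auto simp: zero_less_mult_iff)
  then show ?thesis
    using False by simp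
qed

lemma fractional_integral_rescale:
  fixes \<beta> t :: real
  assumes "0 < t"
  shows "(LINT s:{0<..<t}|lebesgue. (t - s) powr (\<beta> - 1) * \<rho> s)
       = (LINT \<sigma>:{0<..<1}|lebesgue.
            (1 - \<sigma>) powr (\<beta> - 1) * \<sigma> powr (- \<beta>) * ((t * \<sigma>) powr \<beta> * \<rho> (t * \<sigma>)))"
proof -
  have "(LINT s:{0<..<t}|lebesgue. (t - s) powr (\<beta> - 1) * \<rho> s)
      = (LINT \<sigma>|lebesgue. t *
          (indicator {0<..<t} (t * \<sigma>) *\<^sub>R ((t - t * \<sigma>) powr (\<beta> - 1) * \<rho> (t * \<sigma>))))"
    unfolding set_lebesgue_integral_def
    by (subst lebesgue_integral_real_affine[where c = t and t = 0]) (use assms in simp_all)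
  then show ?thesis
    by (simp only: fractional_integrand_rescale[OF assms] set_lebesgue_integral_def)
qed

lemma fractional_integrand_rescale_integrable:
  fixes \<beta> t :: real
  assumes "0 < t"
    and "set_integrable lebesgue {0<..<t} (\<lambda>s. (t - s) powr (\<beta> - 1) * \<rho> s)"
  shows "set_integrable lebesgue {0<..<1}
           (\<lambda>\<sigma>. (1 - \<sigma>) powr (\<beta> - 1) * \<sigma> powr (- \<beta>) * ((t * \<sigma>) powr \<beta> * \<rho> (t * \<sigma>)))"
proof -
  have "integrable lebesgue (\<lambda>\<sigma>. t *
          (indicator {0<..<t} (t * \<sigma>) *\<^sub>R ((t - t * \<sigma>) powr (\<beta> - 1) * \<rho> (t * \<sigma>))))"
    using lebesgue_integrable_real_affine[OF assms(2)[unfolded set_integrable_def], of t 0] assms(1)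
    by (intro integrable_mult_right) simp
  then show ?thesis
    by (simp only: fractional_integrand_rescale[OF assms(1)] set_integrable_def)
qed

text \<open>
  Comparing the values at \<open>a\<close> and \<open>b\<close> without fixing the order of \<open>a\<close> and \<open>b\<close> lets the same
  statement serve the nonincreasing and the nondecreasing case.
\<close>

lemma fractional_integral_le:
  fixes \<beta> a b :: real
  assumes "0 < a" and "0 < b"
    and "set_integrable lebesgue {0<..<a} (\<lambda>s. (a - s) powr (\<beta> - 1) * \<rho> s)"
    and "set_integrable lebesgue {0<..<b} (\<lambda>s. (b - s) powr (\<beta> - 1) * \<rho> s)"
    and "\<And>\<sigma>. 0 < \<sigma> \<Longrightarrow> (a * \<sigma>) powr \<beta> * \<rho> (a * \<sigma>) \<le> (b * \<sigma>) powr \<beta> * \<rho> (b * \<sigma>)"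
  shows "(LINT s:{0<..<a}|lebesgue. (a - s) powr (\<beta> - 1) * \<rho> s)
       \<le> (LINT s:{0<..<b}|lebesgue. (b - s) powr (\<beta> - 1) * \<rho> s)"
  unfolding fractional_integral_rescale[OF assms(1)] fractional_integral_rescale[OF assms(2)]
  using assms
  by (intro set_integral_mono fractional_integrand_rescale_integrable mult_left_mono) auto

theorem lemma2p6:
  fixes \<beta> :: real and \<rho> y :: "real \<Rightarrow> real"
  assumes "0 < \<beta>" and "\<beta> < 1"
    and "continuous_on {0<..} \<rho>" and "\<rho> \<in> L1_loc"
    and "\<And>t. 0 < t \<Longrightarrow> y t = (LINT s:{0<..<t}|lebesgue. (t - s) powr (\<beta> - 1) * \<rho> s)"
  shows "(antimono_on {0<..} (\<lambda>t. t powr \<beta> * \<rho> t) \<longrightarrow> antimono_on {0<..} y) \<and>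
         (mono_on {0<..} (\<lambda>t. t powr \<beta> * \<rho> t) \<longrightarrow> mono_on {0<..} y)"
proof -
  have integrable: "set_integrable lebesgue {0<..<t} (\<lambda>s. (t - s) powr (\<beta> - 1) * \<rho> s)"
    if "0 < t" for t
  proof -
    have "is_interval {0<..<t} \<and> bounded {0<..<t} \<and> {0<..<t} \<subseteq> {0..}"
      by (auto simp: is_interval_oo)
    then have "set_integrable lebesgue {0<..<t} \<rho>"
      using \<open>\<rho> \<in> L1_loc\<close> unfolding L1_loc_def by blast
    then show ?thesis
      using fractional_integrand_set_integrable assms(1-3) that by blast
  qed
  have le: "y a \<le> y b"
    if "0 < a" "0 < b"
      and "\<And>\<sigma>. 0 < \<sigma> \<Longrightarrow> (a * \<sigma>) powr \<beta> * \<rho> (a * \<sigma>) \<le> (b * \<sigma>) powr \<beta> * \<rho> (b * \<sigma>)" for a b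
    unfolding assms(5)[OF that(1)] assms(5)[OF that(2)]
    using that by (intro fractional_integral_le integrable)
  show ?thesis
  proof (intro conjI impI)
    assume g: "antimono_on {0<..} (\<lambda>t. t powr \<beta> * \<rho> t)"
    show "antimono_on {0<..} y"
    proof (rule monotone_onI)
      fix a b :: real assume "a \<in> {0<..}" "b \<in> {0<..}" "a \<le> b"
      then show "y b \<le> y a"
        by (intro le monotone_onD[OF g]) auto
    qed
  next
    assume g: "mono_on {0<..} (\<lambda>t. t powr \<beta> * \<rho> t)"
    show "mono_on {0<..} y"
    proof (rule monotone_onI)
      fix a b :: real assume "a \<in> {0<..}" "b \<in> {0<..}" "a \<le> b"
      then show "y a \<le> y b"
        by (intro le monotone_onD[OF g]) auto
    qed
  qed
qed

end
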